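(* For any nonnegative integer $n$, $F_2(n)=p_{4,2}(n,\text{blue})$.
   Context: A two-color partition of $n$ is a finite multiset of positive integers (parts), each part colored red or blue, whose sum is $n$ (the same integer in two different colors counts as two different kinds of parts). For a nonnegative integer $n$, $\mathcal{F}(n)$ is the set of two-color partitions of $n$ in which even parts may occur only in blue color (odd parts may occur in either color; repetitions are allowed). $F_2(n)$ is the number of partitions in $\mathcal{F}(n)$ in which the number of even parts (counted with multiplicity) is even. For $\pi\in\mathcal{F}(n)$, $\operatorname{mex}_{4,2}(\pi,\text{blue})$ is the smallest positive integer $\equiv 2\pmod 4$ that is not a part of $\pi$ (such parts can occur only in blue). $p_{4,2}(n,\text{blue})$ is the number of partitions $\pi\in\mathcal{F}(n)$ with $\operatorname{mex}_{4,2}(\pi,\text{blue})\equiv 2\pmod 8$. *)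

theory Defs
  imports "HOL-Library.Multiset" "HOL-Number_Theory.Cong"
begin

datatype color = Red | Blue

definition two_color_partitions :: "nat \<Rightarrow> (nat \<times> color) multiset set" where
  "two_color_partitions n =
     {\<pi>. (\<forall>p \<in># \<pi>. fst p > 0) \<and> (\<Sum>p \<in># \<pi>. fst p) = n}"

definition F :: "nat \<Rightarrow> (nat \<times> color) multiset set" where
  "F n = {\<pi> \<in> two_color_partitions n. \<forall>p \<in># \<pi>. even (fst p) \<longrightarrow> snd p = Blue}"

definition F2 :: "nat \<Rightarrow> nat" where
  "F2 n = card {\<pi> \<in> F n. even (size {#p \<in># \<pi>. even (fst p)#})}"

text \<open>The minimal excludant along the residue class of \<open>a\<close> modulo \<open>A\<close>, among the parts of
  colour \<open>c\<close>. The least element exists whenever \<open>A > 0\<close>, as \<open>\<pi>\<close> is finite.\<close>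

definition mex :: "nat \<Rightarrow> nat \<Rightarrow> (nat \<times> color) multiset \<Rightarrow> color \<Rightarrow> nat" where
  "mex A a \<pi> c = (LEAST m. m > 0 \<and> [m = a] (mod A) \<and> (m, c) \<notin># \<pi>)"

definition p42 :: "nat \<Rightarrow> color \<Rightarrow> nat" where
  "p42 n c = card {\<pi> \<in> F n. [mex 4 2 \<pi> c = 2] (mod 8)}"

text \<open>The sets counted above are finite, so \<open>card\<close> is the actual number of partitions.\<close>

lemma size_le_sum_parts:
  fixes \<pi> :: "(nat \<times> color) multiset"
  assumes "\<forall>p \<in># \<pi>. fst p > 0"
  shows "size \<pi> \<le> (\<Sum>p \<in># \<pi>. fst p)"
  using assms by (induction \<pi>) auto

lemma finite_two_color_partitions: "finite (two_color_partitions n)"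
proof (rule finite_subset)
  let ?P = "{..n} \<times> {Red, Blue}"
  show "two_color_partitions n \<subseteq> mset ` {xs. set xs \<subseteq> ?P \<and> length xs \<le> n}"
  proof
    fix \<pi> assume "\<pi> \<in> two_color_partitions n"
    then have pos: "\<forall>p \<in># \<pi>. fst p > 0" and sum: "(\<Sum>p \<in># \<pi>. fst p) = n"
      by (auto simp: two_color_partitions_def)
    have "fst p \<le> n" if "p \<in># \<pi>" for p
      using that sum by (auto dest!: multi_member_split)
    moreover have "{Red, Blue} = UNIV"
      using color.exhaust by auto
    ultimately have "set_mset \<pi> \<subseteq> ?P"
      by fastforce
    moreover have "size \<pi> \<le> n"
      using size_le_sum_parts[OF pos] sum by simp
    moreover obtain xs where "\<pi> = mset xs"
      by (metis ex_mset)
    ultimately show "\<pi> \<in> mset ` {xs. set xs \<subseteq> ?P \<and> length xs \<le> n}"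
      by auto
  qed
  show "finite (mset ` {xs. set xs \<subseteq> ?P \<and> length xs \<le> n})"
    by (intro finite_imageI finite_lists_length_le) simp
qed

lemma finite_F: "finite (F n)"
  by (rule finite_subset[OF _ finite_two_color_partitions]) (auto simp: F_def)

lemma mex_exists:
  fixes \<pi> :: "(nat \<times> color) multiset"
  assumes "A > 0"
  shows "\<exists>m. m > 0 \<and> [m = a] (mod A) \<and> (m, c) \<notin># \<pi>"
proof (rule ccontr)
  assume neg: "\<not> ?thesis"
  have "(a + A * Suc k) \<in> fst ` set_mset \<pi>" for k
  proof -
    have "[a + A * Suc k = a] (mod A)"
      unfolding cong_def by (rule mod_mult_self2)
    then have "(a + A * Suc k, c) \<in># \<pi>"
      using neg assms by auto
    then show ?thesis
      by (metis fst_conv image_eqI)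
  qed
  then have "range (\<lambda>k. a + A * Suc k) \<subseteq> fst ` set_mset \<pi>"
    by blast
  then have "finite (range (\<lambda>k. a + A * Suc k))"
    by (rule finite_subset) simp
  moreover have "inj (\<lambda>k. a + A * Suc k)"
    using assms by (auto simp: inj_on_def)
  ultimately show False
    using finite_imageD by blast
qed

end

theory Submission
  imports Defs "HOL-Computational_Algebra.Formal_Power_Series"
begin

text \<open>
  Write \<open>G\<close> for the generating function of the partitions in \<open>F n\<close>, and \<open>D\<close> for the one in which each
  partition carries the sign \<open>(-1)^e\<close>, where \<open>e\<close> is its number of even parts. Then \<open>2 * F2 n\<close> is
  the coefficient of \<open>q^n\<close> in \<open>G + D\<close>. Both are products over the possible parts, and the odd parts
  contribute the same factor to each, so

  \<open>D / G = \<Prod>j\<ge>1. (1 - q^(2*j)) / (1 + q^(2*j))\<close>.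

  By an identity of Gauss this quotient is \<open>1 + 2 * (\<Sum>s\<ge>1. (-1)^s * q^(2*s^2))\<close>.

  The squares also come from the mex. The numbers \<open>2, 6, \<dots>, 4*j-2\<close> sum to \<open>2*j^2\<close>, so the
  partitions in \<open>F n\<close> that contain all of them in blue correspond to \<open>F (n - 2*j^2)\<close>. The mex is
  \<open>4*K+2\<close>, where \<open>K\<close> is the largest such \<open>j\<close>, and it is 2 modulo 8 exactly when \<open>K\<close> is even, that
  is, when \<open>\<Sum>j\<le>K. (-1)^j\<close> is 1 rather than 0. Hence the generating function of \<open>p42 n Blue\<close> is
  \<open>G * (\<Sum>j\<ge>0. (-1)^j * q^(2*j^2))\<close>, which is half of \<open>G + D\<close> (lemmas
  \<open>p42_eq_alternating_sum\<close>, \<open>twice_F2\<close> and \<open>even_sign_gf_nth\<close>).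

  Only finitely many part sizes matter for the coefficient of \<open>q^n\<close>. All products are therefore
  taken over parts of size at most \<open>n\<close>, and Gauss's identity is used in a finite form due to Shanks
  (lemma \<open>gauss_square_finite\<close>): truncating product and sum at \<open>N\<close> leaves an error divisible by
  \<open>q^(N+1)\<close>.
\<close>

section \<open>A finite form of Gauss's square identity\<close>

text \<open>Multiplying Shanks's identity by \<open>\<Prod>j=1..n. 1 + q^j\<close> clears its denominators and makes it valid
  in every commutative ring. The proof is by induction on \<open>n\<close>: each summand on the right
  for \<open>m + 1\<close> is \<open>1 + q^(m+1)\<close> times that for \<open>m\<close>, plus a telescoping difference.\<close>

lemma gauss_square_finite:
  fixes q :: "'a::comm_ring_1"
  shows "(1 + 2 * (\<Sum>s=1..n. (-1)^s * q^(s^2))) * (\<Prod>j=1..n. 1 + q^j) =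
    (\<Prod>j=1..n. 1 - q^j) +
    2 * (\<Sum>s=1..n. (-1)^s * q^(s*(n+1)) * (\<Prod>j\<in>{1..<s}. 1 + q^j) * (\<Prod>j\<in>{s<..n}. 1 - q^j))"
proof (induction n)
  case 0
  then show ?case by simp
next
  case (Suc m)
  define E where "E s = (\<Prod>j\<in>{1..<s}. 1 + q^j)" for s
  define u where "u n s = (-1)^s * q^(s*(n+1)) * E s * (\<Prod>j\<in>{s<..n}. 1 - q^j)" for n s
  \<comment> \<open>The telescoping certificate, in the style of Wilf and Zeilberger.\<close>
  define A where "A s = (-1)^s * q^(s*(m+1)) * E s * (\<Prod>j\<in>{s..m}. 1 - q^j)" for s
  have step: "u (Suc m) s = (1 + q^Suc m) * u m s + (A (Suc s) - A s)" if s: "s \<in> {1..m}" for s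
  proof -
    define R where "R = (\<Prod>j\<in>{s<..m}. 1 - q^j)"
    have E: "E (Suc s) = E s * (1 + q^s)"
      using s by (simp add: E_def)
    have "{s..m} = insert s {s<..m}" "{s<..Suc m} = insert (Suc m) {s<..m}"
      "{Suc s..m} = {s<..m}"
      using s by auto
    then have Q: "(\<Prod>j\<in>{s..m}. 1 - q^j) = (1 - q^s) * R"
      "(\<Prod>j\<in>{s<..Suc m}. 1 - q^j) = (1 - q^Suc m) * R"
      "(\<Prod>j\<in>{Suc s..m}. 1 - q^j) = R"
      by (simp_all add: R_def)
    have p: "q^(s*(Suc m+1)) = q^(s*(m+1)) * q^s" "q^(Suc s*(m+1)) = q^(s*(m+1)) * q^Suc m"
      by (simp_all add: power_add algebra_simps)
    show ?thesis
      unfolding u_def A_def E Q p R_def[symmetric] power_Suc[of "-1"]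
      by (simp add: algebra_simps del: power_Suc)
  qed
  define Q where "Q = (\<Prod>j=1..m. 1 - q^j)"
  define G where "G = 1 + 2 * (\<Sum>s=1..m. (-1)^s * q^(s^2))"
  have EP: "(\<Prod>j=1..k. 1 + q^j) = E (Suc k)" for k
    by (simp add: E_def atLeastLessThanSuc_atLeastAtMost)
  have IH: "G * E (Suc m) = Q + 2 * (\<Sum>s=1..m. u m s)"
    using Suc.IH unfolding EP Q_def G_def u_def E_def by simp
  have "(\<Sum>s=1..m. A (Suc s) - A s) = A (Suc m) - A 1"
    by (subst sum_Suc_diff) auto
  moreover have "A 1 = - (q^Suc m * Q)"
    by (simp add: A_def E_def Q_def)
  moreover have sq: "q^((Suc m)^2) = q^(Suc m * (m+1))"
    by (simp add: power2_eq_square)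
  then have "A (Suc m) = (-1)^Suc m * q^((Suc m)^2) * E (Suc m)"
    by (simp add: A_def)
  ultimately have tele: "(\<Sum>s=1..m. u (Suc m) s) = (1 + q^Suc m) * (\<Sum>s=1..m. u m s)
      + (-1)^Suc m * q^((Suc m)^2) * E (Suc m) + q^Suc m * Q"
    by (simp add: step sum.distrib sum_distrib_left)
  have top: "u (Suc m) (Suc m) = (-1)^Suc m * q^((Suc m)^2) * q^Suc m * E (Suc m)"
    by (simp add: u_def power2_eq_square power_add algebra_simps)
  have ESuc: "E (Suc (Suc m)) = E (Suc m) * (1 + q^Suc m)"
    by (simp add: E_def)
  have G': "1 + 2 * (\<Sum>s=1..Suc m. (-1)^s * q^(s^2)) = G + 2 * ((-1)^Suc m * q^((Suc m)^2))"
    by (simp add: G_def algebra_simps)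
  have Q': "(\<Prod>j=1..Suc m. 1 - q^j) = Q * (1 - q^Suc m)"
    by (simp add: Q_def)
  have U': "(\<Sum>s=1..Suc m. u (Suc m) s) = (\<Sum>s=1..m. u (Suc m) s) + u (Suc m) (Suc m)"
    by simp
  \<comment> \<open>Here \<open>y\<close> is the new square term, \<open>e\<close> and \<open>p\<close> stand for \<open>E (Suc m)\<close> and \<open>q^Suc m\<close>, and \<open>S\<close> is
    the old sum; as plain variables they let ring normalisation ignore the exponents.\<close>
  have "(G + 2 * y) * (e * (1 + p)) = Q * (1 - p) + 2 * ((1 + p) * S + y * e + p * Q + y * p * e)"
    if "G * e = Q + 2 * S" for y e p S
  proof -
    have "(G + 2 * y) * (e * (1 + p)) = (G * e) * (1 + p) + 2 * y * e * (1 + p)"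
      by (simp add: algebra_simps)
    also have "\<dots> = Q * (1 - p) + 2 * ((1 + p) * S + y * e + p * Q + y * p * e)"
      unfolding that by (simp add: algebra_simps)
    finally show ?thesis .
  qed
  from this[OF IH]
  have "(1 + 2 * (\<Sum>s=1..Suc m. (-1)^s * q^(s^2))) * (\<Prod>j=1..Suc m. 1 + q^j) =
    (\<Prod>j=1..Suc m. 1 - q^j) + 2 * (\<Sum>s=1..Suc m. u (Suc m) s)"
    unfolding G' EP Q' U' tele top ESuc .
  then show ?case
    unfolding u_def E_def .
qed

text \<open>Every error term contains \<open>q^(s*(n+1))\<close> with \<open>s \<ge> 1\<close>.\<close>

lemma gauss_square_dvd:
  fixes q :: "'a::comm_ring_1"
  shows "q^(n+1) dvd (1 + 2 * (\<Sum>s=1..n. (-1)^s * q^(s^2))) * (\<Prod>j=1..n. 1 + q^j)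
    - (\<Prod>j=1..n. 1 - q^j)"
  unfolding gauss_square_finite add_diff_cancel_left'
proof (rule dvd_mult, rule dvd_sum)
  fix s assume "s \<in> {1..n}"
  then have "n + 1 \<le> s * (n + 1)"
    using mult_le_mono1[of 1 s "n + 1"] by simp
  then have "q^(n+1) dvd (-1)^s * q^(s*(n+1))"
    by (intro dvd_mult le_imp_power_dvd)
  then show "q^(n+1) dvd (-1)^s * q^(s*(n+1)) * (\<Prod>j\<in>{1..<s}. 1 + q^j) * (\<Prod>j\<in>{s<..n}. 1 - q^j)"
    by (rule dvd_mult2[OF dvd_mult2])
qed

section \<open>Signed generating functions of multisets\<close>

unbundle fps_syntax

definition multisets_of_weight :: "('a \<Rightarrow> nat) \<Rightarrow> 'a set \<Rightarrow> nat \<Rightarrow> 'a multiset set" where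
  "multisets_of_weight w S n = {M. set_mset M \<subseteq> S \<and> (\<Sum>x\<in>#M. w x) = n}"

definition multiset_gf :: "('a \<Rightarrow> nat) \<Rightarrow> ('a \<Rightarrow> int) \<Rightarrow> 'a set \<Rightarrow> int fps" where
  "multiset_gf w s S = Abs_fps (\<lambda>n. \<Sum>M\<in>multisets_of_weight w S n. \<Prod>x\<in>#M. s x)"

lemma finite_multisets_of_weight:
  assumes "finite S" and pos: "\<And>a. a \<in> S \<Longrightarrow> w a > 0"
  shows "finite (multisets_of_weight w S n)"
proof (rule finite_subset)
  show "multisets_of_weight w S n \<subseteq> mset ` {xs. set xs \<subseteq> S \<and> length xs \<le> n}"
  proof
    fix M assume M: "M \<in> multisets_of_weight w S n"
    have "set_mset M \<subseteq> S \<Longrightarrow> size M \<le> (\<Sum>x\<in>#M. w x)"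
    proof (induction M)
      case (add x M)
      then show ?case
        using pos[of x] by simp
    qed simp
    moreover obtain xs where "M = mset xs"
      by (metis ex_mset)
    ultimately show "M \<in> mset ` {xs. set xs \<subseteq> S \<and> length xs \<le> n}"
      using M by (auto simp: multisets_of_weight_def)
  qed
  show "finite (mset ` {xs. set xs \<subseteq> S \<and> length xs \<le> n})"
    using assms(1) by (intro finite_imageI finite_lists_length_le)
qed

lemma bij_betw_add_mset_weight:
  assumes "a \<in> S" "w a \<le> n"
  shows "bij_betw (add_mset a) (multisets_of_weight w S (n - w a))
    {M \<in> multisets_of_weight w S n. a \<in># M}"
proof (rule bij_betwI[where g = "\<lambda>M. M - {#a#}"])
  show "(\<lambda>M. M - {#a#}) \<in> {M \<in> multisets_of_weight w S n. a \<in># M}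
      \<rightarrow> multisets_of_weight w S (n - w a)"
    by (auto simp: multisets_of_weight_def dest: in_diffD dest!: multi_member_split)
qed (use assms in \<open>auto simp: multisets_of_weight_def\<close>)

text \<open>Multisets over \<open>insert a S\<close> either avoid \<open>a\<close> or arise from another such multiset by adding one
  copy of \<open>a\<close>, which multiplies the sign by \<open>s a\<close> and raises the weight by \<open>w a\<close>.\<close>

lemma multiset_gf_insert:
  assumes "finite S" "a \<notin> S" and pos: "\<And>b. b \<in> insert a S \<Longrightarrow> w b > 0"
  shows "multiset_gf w s (insert a S) * (1 - fps_const (s a) * fps_X ^ w a) = multiset_gf w s S"
proof -
  let ?T = "insert a S" and ?P = "\<lambda>M. \<Prod>x\<in>#M. s x"
  have "multiset_gf w s ?T $ n =
      multiset_gf w s S $ n + (fps_const (s a) * (fps_X ^ w a * multiset_gf w s ?T)) $ n" for n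
  proof -
    have fin: "finite (multisets_of_weight w ?T n)"
      using assms by (intro finite_multisets_of_weight) auto
    have split: "multisets_of_weight w ?T n =
        multisets_of_weight w S n \<union> {M \<in> multisets_of_weight w ?T n. a \<in># M}"
      by (auto simp: multisets_of_weight_def)
    have "(\<Sum>M\<in>multisets_of_weight w ?T n. ?P M) =
        (\<Sum>M\<in>multisets_of_weight w S n. ?P M) +
        (\<Sum>M | M \<in> multisets_of_weight w ?T n \<and> a \<in># M. ?P M)"
      by (subst split, rule sum.union_disjoint)
        (use fin \<open>a \<notin> S\<close> in \<open>auto simp: multisets_of_weight_def elim: rev_finite_subset\<close>)
    moreover have "(\<Sum>M | M \<in> multisets_of_weight w ?T n \<and> a \<in># M. ?P M) =
        (fps_const (s a) * (fps_X ^ w a * multiset_gf w s ?T)) $ n"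
    proof (cases "w a \<le> n")
      case True
      have "(\<Sum>M | M \<in> multisets_of_weight w ?T n \<and> a \<in># M. ?P M) =
          (\<Sum>M\<in>multisets_of_weight w ?T (n - w a). ?P (add_mset a M))"
        using bij_betw_add_mset_weight[of a ?T w n] True
        by (intro sum.reindex_bij_betw[symmetric]) auto
      then show ?thesis
        using True by (simp add: multiset_gf_def fps_X_power_mult_nth sum_distrib_left)
    next
      case False
      then have "{M. M \<in> multisets_of_weight w ?T n \<and> a \<in># M} = {}"
        by (auto simp: multisets_of_weight_def dest!: multi_member_split)
      then show ?thesis
        using False by (simp only: sum.empty) (simp add: fps_X_power_mult_nth)
    qed
    ultimately show ?thesis
      by (simp add: multiset_gf_def)
  qed
  then have "multiset_gf w s ?T =
      multiset_gf w s S + fps_const (s a) * (fps_X ^ w a * multiset_gf w s ?T)"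
    by (intro fps_ext) simp
  then show ?thesis
    by (simp add: algebra_simps)
qed

lemma multiset_gf_product:
  assumes "finite S" and "\<And>a. a \<in> S \<Longrightarrow> w a > 0"
  shows "multiset_gf w s S * (\<Prod>a\<in>S. 1 - fps_const (s a) * fps_X ^ w a) = 1"
  using assms
proof (induction S rule: finite_induct)
  case empty
  have "multisets_of_weight w {} n = (if n = 0 then {{#}} else {})" for n
    by (auto simp: multisets_of_weight_def)
  then show ?case
    by (intro fps_ext) (simp add: multiset_gf_def)
next
  case (insert a S)
  then show ?case
    using multiset_gf_insert[of S a w s] by (simp add: mult.assoc[symmetric])
qed

section \<open>Two-color partitions with blue even parts\<close>

text \<open>The bound \<open>n\<close> makes the set of parts finite, so that the product formula applies, and loses
  nothing for partitions of numbers up to \<open>n\<close>.\<close>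

definition admissible_parts :: "nat \<Rightarrow> (nat \<times> color) set" where
  "admissible_parts n = {p. 0 < fst p \<and> fst p \<le> n \<and> (even (fst p) \<longrightarrow> snd p = Blue)}"

definition even_sign :: "nat \<times> color \<Rightarrow> int" where
  "even_sign p = (if even (fst p) then -1 else 1)"

lemma finite_admissible_parts: "finite (admissible_parts n)"
proof (rule finite_subset)
  show "admissible_parts n \<subseteq> {..n} \<times> {Red, Blue}"
    by (auto simp: admissible_parts_def) (metis color.exhaust)
qed simp

lemma F_eq_multisets_of_weight:
  assumes "m \<le> n"
  shows "F m = multisets_of_weight fst (admissible_parts n) m"
proof -
  have "fst p \<le> n" if "\<pi> \<in> F m" "p \<in># \<pi>" for p \<pi>
    using that assms by (auto simp: F_def two_color_partitions_def dest!: multi_member_split)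
  then show ?thesis
    by (auto simp: F_def two_color_partitions_def multisets_of_weight_def admissible_parts_def
        subset_iff)
qed

lemma multiset_gf_card_F:
  "m \<le> n \<Longrightarrow> multiset_gf fst (\<lambda>_. 1) (admissible_parts n) $ m = int (card (F m))"
  using F_eq_multisets_of_weight[of m n] by (simp add: multiset_gf_def)

lemma prod_even_sign: "(\<Prod>p\<in>#\<pi>. even_sign p) = (-1) ^ size {#p \<in># \<pi>. even (fst p)#}"
  by (induction \<pi>) (auto simp: even_sign_def)

text \<open>Each partition contributes 2 or 0 to the right-hand side, according to the parity of its number
  of even parts.\<close>

lemma twice_F2:
  "2 * int (F2 n) = int (card (F n)) + multiset_gf fst even_sign (admissible_parts n) $ n"
proof -
  let ?e = "\<lambda>\<pi>. even (size {#p \<in># \<pi>. even (fst p)#})"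
  have "multiset_gf fst even_sign (admissible_parts n) $ n = (\<Sum>\<pi>\<in>F n. 2 * of_bool (?e \<pi>) - 1)"
    by (simp add: multiset_gf_def F_eq_multisets_of_weight[symmetric] prod_even_sign
        cong: sum.cong) (intro sum.cong, auto)
  also have "\<dots> = 2 * int (F2 n) - int (card (F n))"
    by (simp add: sum_subtractf sum_distrib_left[symmetric] F2_def finite_F Int_def)
  finally show ?thesis by simp
qed

lemma prod_admissible_parts:
  fixes f :: "nat \<times> color \<Rightarrow> 'a::comm_monoid_mult"
  shows "(\<Prod>p\<in>admissible_parts n. f p) =
    (\<Prod>p | p \<in> admissible_parts n \<and> odd (fst p). f p) * (\<Prod>j=1..n div 2. f (2*j, Blue))"
proof -
  have split: "admissible_parts n =
      {p \<in> admissible_parts n. odd (fst p)} \<union> (\<lambda>j. (2*j, Blue)) ` {1..n div 2}"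
  proof (intro set_eqI iffI)
    fix p assume p: "p \<in> admissible_parts n"
    show "p \<in> {p \<in> admissible_parts n. odd (fst p)} \<union> (\<lambda>j. (2*j, Blue)) ` {1..n div 2}"
    proof (cases "odd (fst p)")
      case False
      then have "p = (2 * (fst p div 2), Blue)" "fst p div 2 \<in> {1..n div 2}"
        using p by (auto simp: admissible_parts_def prod_eq_iff elim!: evenE)
      then show ?thesis by blast
    qed (use p in simp)
  qed (auto simp: admissible_parts_def)
  have "inj_on (\<lambda>j. (2*j, Blue)) {1..n div 2}"
    by (auto simp: inj_on_def)
  then show ?thesis
    by (subst split, subst prod.union_disjoint)
      (auto simp: finite_admissible_parts prod.reindex intro: finite_subset)
qed

text \<open>This is \<open>D = G * (1 + 2 * (\<Sum>s\<ge>1. (-1)^s * q^(2*s^2)))\<close> at the coefficient of \<open>q^n\<close>. Gauss's identity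
  enters with base \<open>fps_X^2\<close>, since the even parts are the doubles of \<open>1, \<dots>, n div 2\<close>; truncation
  at \<open>N = n div 2\<close> then only affects exponents from \<open>2*N + 2 > n\<close> on.\<close>

lemma even_sign_gf_nth:
  "multiset_gf fst even_sign (admissible_parts n) $ n =
    ((1 + 2 * (\<Sum>s=1..n div 2. (-1)^s * (fps_X^2)^(s^2)))
      * multiset_gf fst (\<lambda>_. 1) (admissible_parts n)) $ n"
proof -
  define D where "D = multiset_gf fst even_sign (admissible_parts n)"
  define G where "G = multiset_gf fst (\<lambda>_. 1) (admissible_parts n)"
  define N where "N = n div 2"
  define q :: "int fps" where "q = fps_X^2"
  define R where "R = (\<Prod>p | p \<in> admissible_parts n \<and> odd (fst p). 1 - fps_X ^ fst p :: int fps)"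
  define E where "E = (\<Prod>j=1..N. 1 + q^j)"
  define Q where "Q = (\<Prod>j=1..N. 1 - q^j)"
  define S where "S = 1 + 2 * (\<Sum>s=1..N. (-1)^s * q^(s^2))"
  have pos: "fst p > 0" if "p \<in> admissible_parts n" for p
    using that by (simp add: admissible_parts_def)
  have minus_one: "fps_const (-1::int) = -1"
    by (metis fps_const_neg fps_const_1_eq_1)
  have D: "D * (R * E) = 1"
  proof -
    have "(\<Prod>p\<in>admissible_parts n. 1 - fps_const (even_sign p) * fps_X ^ fst p) = R * E"
      by (rule trans[OF prod_admissible_parts])
        (simp add: R_def E_def N_def q_def even_sign_def minus_one power_mult[symmetric])
    then show ?thesis
      using multiset_gf_product[of "admissible_parts n" fst even_sign] finite_admissible_parts pos
      by (simp add: D_def)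
  qed
  have G: "G * (R * Q) = 1"
  proof -
    have "(\<Prod>p\<in>admissible_parts n. 1 - fps_const 1 * fps_X ^ fst p) = R * Q"
      by (rule trans[OF prod_admissible_parts])
        (simp add: R_def Q_def N_def q_def power_mult[symmetric])
    then show ?thesis
      using multiset_gf_product[of "admissible_parts n" fst "\<lambda>_. 1"] finite_admissible_parts pos
      by (simp add: G_def)
  qed
  have "q^(N+1) dvd S * E - Q"
    unfolding S_def E_def Q_def by (rule gauss_square_dvd)
  then obtain Y where Y: "S * E - Q = q^(N+1) * Y"
    by (rule dvdE)
  \<comment> \<open>Multiplying by the two products equal to 1 brings out the error of the finite identity.\<close>
  have "S * G - D = S * G * (D * (R * E)) - D * (G * (R * Q))"
    by (simp only: D G mult_1_right)
  also have "\<dots> = (S * E - Q) * (G * D * R)"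
    by (simp add: algebra_simps)
  also have "\<dots> = q^(N+1) * (Y * G * D * R)"
    by (simp only: Y mult.assoc)
  finally have "S * G - D = q^(N+1) * (Y * G * D * R)" .
  moreover have "q^(N+1) = fps_X^(2*N+2)"
    unfolding q_def power_mult[symmetric] by simp
  moreover have "n < 2*N+2"
    by (simp add: N_def)
  ultimately have "(S * G - D) $ n = 0"
    by (simp only: fps_X_power_mult_nth) simp
  then show ?thesis
    by (simp add: S_def G_def D_def N_def q_def)
qed

section \<open>The mex statistic\<close>

definition mex_chain :: "nat \<Rightarrow> (nat \<times> color) multiset" where
  "mex_chain j = mset_set ((\<lambda>i. (4*i+2, Blue)) ` {..<j})"

lemma mex_chain_subset_iff: "mex_chain j \<subseteq># \<pi> \<longleftrightarrow> (\<forall>i<j. (4*i+2, Blue) \<in># \<pi>)"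
  by (auto simp: mex_chain_def subseteq_mset_def count_mset_set' Suc_le_eq image_iff)

lemma set_mex_chain: "set_mset (mex_chain j) = (\<lambda>i. (4*i+2, Blue)) ` {..<j}"
  by (simp add: mex_chain_def)

lemma weight_mex_chain: "(\<Sum>p\<in>#mex_chain j. fst p) = 2*j^2"
proof -
  have inj: "inj_on (\<lambda>i. (4*i+2, Blue)) {..<j}"
    by (auto simp: inj_on_def)
  have "(\<Sum>p\<in>#mex_chain j. fst p) = (\<Sum>i<j. 4*i+2)"
    unfolding mex_chain_def sum_unfold_sum_mset[symmetric]
    by (subst sum.reindex[OF inj]) simp
  also have "\<dots> = 2*j^2"
    by (induction j) (auto simp: power2_eq_square)
  finally show ?thesis .
qed

text \<open>Removing one copy of each part of the chain is a bijection onto the partitions of the rest.\<close>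

lemma card_F_mex_chain:
  "card {\<pi> \<in> F n. mex_chain j \<subseteq># \<pi>} = (if 2*j^2 \<le> n then card (F (n - 2*j^2)) else 0)"
proof (cases "2*j^2 \<le> n")
  case True
  have "bij_betw (\<lambda>\<pi>. mex_chain j + \<pi>) (F (n - 2*j^2)) {\<pi> \<in> F n. mex_chain j \<subseteq># \<pi>}"
  proof (rule bij_betwI[where g = "\<lambda>\<pi>. \<pi> - mex_chain j"])
    show "(\<lambda>\<pi>. mex_chain j + \<pi>) \<in> F (n - 2*j^2) \<rightarrow> {\<pi> \<in> F n. mex_chain j \<subseteq># \<pi>}"
      using True by (auto simp: F_def two_color_partitions_def weight_mex_chain set_mex_chain)
    show "(\<lambda>\<pi>. \<pi> - mex_chain j) \<in> {\<pi> \<in> F n. mex_chain j \<subseteq># \<pi>} \<rightarrow> F (n - 2*j^2)"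
      by (auto simp: F_def two_color_partitions_def weight_mex_chain subset_mset.le_iff_add)
  qed auto
  from bij_betw_same_card[OF this] show ?thesis
    using True by simp
next
  case False
  then have "{\<pi> \<in> F n. mex_chain j \<subseteq># \<pi>} = {}"
    by (auto simp: F_def two_color_partitions_def weight_mex_chain subset_mset.le_iff_add)
  then show ?thesis
    using False by (simp only: card.empty) simp
qed

text \<open>The index \<open>K\<close> of the first gap in the progression \<open>2, 6, 10, \<dots>\<close> determines both the mex and
  the chains that are present; it turns the condition on the mex into one on chains.\<close>

lemma mex_4_2_chain_index:
  obtains K where "mex 4 2 \<pi> Blue = 4*K+2" and "\<And>j. mex_chain j \<subseteq># \<pi> \<longleftrightarrow> j \<le> K"
proof
  define K where "K = (LEAST k. (4*k+2, Blue) \<notin># \<pi>)"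
  have form: "\<exists>k. m = 4*k+2" if "[m = 2] (mod 4)" for m :: nat
    using that by (auto simp: cong_def intro!: exI[of _ "m div 4"]) presburger
  obtain m where "[m = 2] (mod 4)" "(m, Blue) \<notin># \<pi>"
    using mex_exists[of 4 2 Blue \<pi>] by auto
  with form have "\<exists>k. (4*k+2, Blue) \<notin># \<pi>"
    by blast
  then have K: "(4*K+2, Blue) \<notin># \<pi>"
    unfolding K_def by (rule LeastI_ex)
  show "mex 4 2 \<pi> Blue = 4*K+2"
    unfolding mex_def
  proof (rule Least_equality)
    show "4*K+2 > 0 \<and> [4*K+2 = 2] (mod 4) \<and> (4*K+2, Blue) \<notin># \<pi>"
      using K by (simp add: cong_def del: add_2_eq_Suc add_2_eq_Suc')
  next
    fix m assume m: "m > 0 \<and> [m = 2] (mod 4) \<and> (m, Blue) \<notin># \<pi>"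
    then obtain k where "m = 4*k+2"
      using form by blast
    with m show "4*K+2 \<le> m"
      unfolding K_def by (auto intro: Least_le)
  qed
  show "mex_chain j \<subseteq># \<pi> \<longleftrightarrow> j \<le> K" for j
    unfolding mex_chain_subset_iff
    using K not_less_Least[of _ "\<lambda>k. (4*k+2, Blue) \<notin># \<pi>"]
    by (metis K_def leI less_le_trans)
qed

text \<open>The chains present are those with \<open>j \<le> K\<close>, and \<open>\<Sum>j\<le>K. (-1)^j\<close> is 1 or 0 according to the
  parity of \<open>K\<close>. Extending the sum to \<open>j \<le> n\<close> makes its range independent of the partition.\<close>

lemma of_bool_mex_eq_sum:
  assumes "\<pi> \<in> F n"
  shows "of_bool ([mex 4 2 \<pi> Blue = 2] (mod 8)) =
    (\<Sum>j\<le>n. (-1)^j * of_bool (mex_chain j \<subseteq># \<pi>) :: int)"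
proof -
  obtain K where mex: "mex 4 2 \<pi> Blue = 4*K+2" and chain: "\<And>j. mex_chain j \<subseteq># \<pi> \<longleftrightarrow> j \<le> K"
    using mex_4_2_chain_index[of \<pi>] by blast
  \<comment> \<open>The parts of the longest chain already sum to \<open>2*K^2\<close>, which bounds \<open>K\<close> by \<open>n\<close>.\<close>
  have "card {\<pi> \<in> F n. mex_chain K \<subseteq># \<pi>} \<noteq> 0"
    using assms chain[of K] finite_F[of n] by (auto simp: card_eq_0_iff)
  then have "2*K^2 \<le> n"
    by (auto simp: card_F_mex_chain split: if_splits)
  then have "K \<le> n"
    by (cases K) (auto simp: power2_eq_square)
  then have "(\<Sum>j\<le>n. (-1)^j * of_bool (mex_chain j \<subseteq># \<pi>) :: int) = (\<Sum>j\<le>K. (-1)^j)"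
    unfolding chain by (intro sum.mono_neutral_cong_right) auto
  also have "\<dots> = of_bool (even K)"
    by (induction K) auto
  also have "even K \<longleftrightarrow> [mex 4 2 \<pi> Blue = 2] (mod 8)"
  proof (cases "even K")
    case True
    then obtain a where "4*K+2 = 2 + 8*a" by (auto elim: evenE)
    with True show ?thesis unfolding mex cong_def by (simp only: mod_mult_self2) simp
  next
    case False
    then obtain a where "4*K+2 = 6 + 8*a" by (auto elim: oddE)
    then have "(4*K+2) mod 8 = 6" by (simp only: mod_mult_self2) simp
    with False show ?thesis unfolding mex cong_def by simp
  qed
  finally show ?thesis by simp
qed

lemma p42_eq_alternating_sum:
  "int (p42 n Blue) = (\<Sum>j\<le>n. if 2*j^2 \<le> n then (-1)^j * int (card (F (n - 2*j^2))) else 0)"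
proof -
  have "int (p42 n Blue) = (\<Sum>\<pi>\<in>F n. of_bool ([mex 4 2 \<pi> Blue = 2] (mod 8)))"
    by (simp add: p42_def finite_F Int_def)
  also have "\<dots> = (\<Sum>\<pi>\<in>F n. \<Sum>j\<le>n. (-1)^j * of_bool (mex_chain j \<subseteq># \<pi>))"
    by (intro sum.cong refl of_bool_mex_eq_sum)
  also have "\<dots> = (\<Sum>j\<le>n. (-1)^j * (\<Sum>\<pi>\<in>F n. of_bool (mex_chain j \<subseteq># \<pi>)))"
    by (subst sum.swap) (simp only: sum_distrib_left)
  also have "\<dots> = (\<Sum>j\<le>n. (-1)^j * int (card {\<pi> \<in> F n. mex_chain j \<subseteq># \<pi>}))"
    by (simp add: finite_F Int_def)
  finally show ?thesis
    by (auto simp: card_F_mex_chain intro!: sum.cong)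
qed

theorem theorem3:
  fixes n :: nat
  shows "F2 n = p42 n Blue"
proof -
  let ?G = "multiset_gf fst (\<lambda>_. 1) (admissible_parts n)"
  define f where "f j = (if 2*j^2 \<le> n then (-1)^j * int (card (F (n - 2*j^2))) else 0)" for j
  have "((-1)^s * (fps_X^2)^(s^2) * ?G) $ n = f s" for s
  proof -
    have "(-1)^s * (fps_X^2)^(s^2) * ?G = fps_const ((-1)^s) * (fps_X^(2*s^2) * ?G)"
      by (simp only: power_mult fps_const_power[symmetric] fps_const_neg[symmetric]
          fps_const_1_eq_1 mult.assoc)
    then show ?thesis
      by (simp only: fps_mult_left_const_nth)
        (simp add: f_def fps_X_power_mult_nth multiset_gf_card_F)
  qed
  then have "((\<Sum>s=1..n div 2. (-1)^s * (fps_X^2)^(s^2)) * ?G) $ n = (\<Sum>s=1..n div 2. f s)"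
    by (simp only: sum_distrib_right fps_sum_nth)
  moreover have "(1 + 2 * H) * ?G = ?G + (H * ?G + H * ?G)" for H
    by (simp add: algebra_simps)
  ultimately have "multiset_gf fst even_sign (admissible_parts n) $ n =
      int (card (F n)) + 2 * (\<Sum>s=1..n div 2. f s)"
    by (simp only: even_sign_gf_nth fps_add_nth multiset_gf_card_F)
  \<comment> \<open>The two sides were truncated differently, but the extra terms vanish.\<close>
  moreover have "(\<Sum>s=1..n div 2. f s) = (\<Sum>s=1..n. f s)"
  proof (intro sum.mono_neutral_left ballI)
    fix s assume "s \<in> {1..n} - {1..n div 2}"
    then have "n < 2 * s" "s \<ge> 1" by auto
    moreover from \<open>s \<ge> 1\<close> have "s \<le> s^2"
      by (simp add: power2_eq_square)
    ultimately show "f s = 0" by (simp add: f_def)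
  qed auto
  moreover have "int (p42 n Blue) = int (card (F n)) + (\<Sum>s=1..n. f s)"
    unfolding p42_eq_alternating_sum f_def[symmetric]
    by (simp add: atMost_atLeast0 sum.atLeast_Suc_atMost f_def)
  ultimately show ?thesis
    using twice_F2[of n] by simp
qed

end
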